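(* Let $y>0$ and let $g\in\mathcal{F}_y$. Then the infimum $$\mathrm{LOI}_y(g)=\inf\Big\{\int_0^y |g'-f'|\,\mathrm{d}\lambda \;:\; f\in\mathcal{F}^{+}_y\Big\}$$ is attained at a function $f_1\in\mathcal{F}^{+}_y$ such that $f_1'=(g')^{+}$ (almost everywhere on $[0,y]$), and thus $$\mathrm{LOI}_y(g)=\int_0^y (g')^{-}\,\mathrm{d}\lambda .$$ Moreover, if $a<b$ are real numbers, $y=b-a$, $g_0:[a,b]\to\mathbf{R}$ is absolutely continuous, and $g$ is given by $g(x)=g_0(x+a)-g_0(a)$ for $x\in[0,y]$, then $$\mathrm{LOI}_{[a,b]}(g_0)=\int_a^b (g_0')^{-}\,\mathrm{d}\lambda .$$
   Context: $\lambda$ denotes Lebesgue measure. For $y>0$, $\mathcal{F}_y$ denotes the set of all absolutely continuous functions $f:[0,y]\to\mathbf{R}$ with $f(0)=0$, and $\mathcal{F}^{+}_y\subset\mathcal{F}_y$ denotes the subset of those $f\in\mathcal{F}_y$ that are non-decreasing. For an absolutely continuous function $f$, $f'$ denotes its (almost everywhere defined) derivative. For a real-valued function $h$, $h^{+}=\max\{h,0\}$ and $h^{-}=\max\{-h,0\}$. The index of lack of increase of $g\in\mathcal{F}_y$ is $$\mathrm{LOI}_y(g)=\inf\Big\{\int_0^y |g'-f'|\,\mathrm{d}\lambda : f\in\mathcal{F}^{+}_y\Big\}.$$ For an absolutely continuous function $g_0$ on $[a,b]$, put $y=b-a$ and $g(x)=g_0(x+a)-g_0(a)$ for $x\in[0,y]$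 (so $g\in\mathcal{F}_y$); the index of lack of increase of $g_0$ on $[a,b]$ is defined by $\mathrm{LOI}_{[a,b]}(g_0):=\mathrm{LOI}_y(g)$. *)

theory Defs
  imports "HOL-Analysis.Analysis"
begin

(* Absolute continuity of a function (the library's absolutely_continuous is about measures). *)
definition absolutely_continuous_on :: "real set \<Rightarrow> (real \<Rightarrow> real) \<Rightarrow> bool" where
  "absolutely_continuous_on S f \<longleftrightarrow>
     (\<forall>\<epsilon>>0. \<exists>\<delta>>0. \<forall>(n::nat) l u.
        (\<forall>i<n. l i < u i \<and> {l i..u i} \<subseteq> S) \<longrightarrow>
        disjoint_family_on (\<lambda>i. {l i<..<u i}) {..<n} \<longrightarrow>
        (\<Sum>i<n. u i - l i) < \<delta> \<longrightarrow>
        (\<Sum>i<n. \<bar>f (u i) - f (l i)\<bar>) < \<epsilon>)"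

(* Functions on [0,y] are total functions whose values outside [0,y] are irrelevant. *)
definition AC0 :: "real \<Rightarrow> (real \<Rightarrow> real) set" where
  "AC0 y = {f. absolutely_continuous_on {0..y} f \<and> f 0 = 0}"

definition AC0_mono :: "real \<Rightarrow> (real \<Rightarrow> real) set" where
  "AC0_mono y = {f \<in> AC0 y. mono_on {0..y} f}"

(* Taking the derivative within S makes it depend only on the values of f on S.
   For f absolutely continuous on an interval it exists almost everywhere; elsewhere it is
   an unspecified value, which neither the integrals nor the AE statements see. *)
abbreviation deriv_within :: "real set \<Rightarrow> (real \<Rightarrow> real) \<Rightarrow> real \<Rightarrow> real" where
  "deriv_within S f x \<equiv> vector_derivative f (at x within S)"

(* The set is nonempty and bounded below by 0, so the real-valued infimum is the true one. *)
definition LOI :: "real \<Rightarrow> (real \<Rightarrow> real) \<Rightarrow> real" where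
  "LOI y g = (INF f\<in>AC0_mono y.
     LINT x:{0..y}|lebesgue. \<bar>deriv_within {0..y} g x - deriv_within {0..y} f x\<bar>)"

definition LOI_on :: "real \<Rightarrow> real \<Rightarrow> (real \<Rightarrow> real) \<Rightarrow> real" where
  "LOI_on a b g0 = LOI (b - a) (\<lambda>x. g0 (x + a) - g0 a)"

end

theory Submission
  imports Defs
begin

text \<open>
  Both assertions rest on a pointwise inequality. If \<open>f\<close> is non-decreasing then \<open>f' \<ge> 0\<close> almost
  everywhere, so \<open>\<bar>g' - f'\<bar> \<ge> (g')\<^sup>-\<close>, with equality where \<open>f' = (g')\<^sup>+\<close>.
  The indefinite integral \<open>f1\<close> of \<open>(g')\<^sup>+\<close> is a competitor that realises equality almost
  everywhere. The formula on \<open>[a, b]\<close> follows by translation.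

  What makes this a proof are two classical facts about functions on \<open>[a, b]\<close>.

  First, an indefinite integral of an integrable function is absolutely continuous
  (\<open>absolutely_continuous_on_indefinite_integral\<close>) and has the integrand as its derivative almost
  everywhere (\<open>indefinite_integral_has_vector_derivative_ae\<close>). This puts \<open>f1\<close> among the competitors.

  Second, conversely, every absolutely continuous function is the indefinite integral of an integrable
  function (\<open>absolutely_continuous_on_imp_indefinite_integral\<close>), so its derivative exists almost
  everywhere and is integrable. Without integrability the integrals in the definition of the index
  would be the default value 0 and could not be compared. For a non-decreasing function the integrand
  is the Radon-Nikodym density of its Stieltjes measure, and it is non-negative
  (\<open>absolutely_continuous_mono_imp_indefinite_integral\<close>). The general case reduces to this one by
  writing the function as the difference of its positive variation and a non-decreasing remainder,
  both absolutely continuous (\<open>absolutely_continuous_on_Jordan_decomposition\<close>).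
\<close>

section \<open>Absolute continuity\<close>

text \<open>
  The form in which absolute continuity is used below: degenerate intervals are harmless, since they
  contribute to neither sum, and any finite index set will do. Index sets that arise naturally are
  pairs of numbers (a packing inside each interval of a packing) and the pieces of a division.
\<close>

lemma absolutely_continuous_on_finite_family:
  assumes ac: "absolutely_continuous_on S f" and "\<epsilon> > 0"
  obtains \<delta> where "\<delta> > 0" "\<And>(I::'i set) l u. finite I \<Longrightarrow>
      (\<And>i. i \<in> I \<Longrightarrow> l i \<le> u i) \<Longrightarrow> (\<And>i. i \<in> I \<Longrightarrow> {l i..u i} \<subseteq> S) \<Longrightarrow>
      disjoint_family_on (\<lambda>i. {l i<..<u i}) I \<Longrightarrow> (\<Sum>i\<in>I. u i - l i) < \<delta> \<Longrightarrow>
      (\<Sum>i\<in>I. \<bar>f (u i) - f (l i)\<bar>) < \<epsilon>"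
proof -
  obtain \<delta> where "\<delta> > 0" and \<delta>: "\<And>(n::nat) l u. (\<forall>i<n. l i < u i \<and> {l i..u i} \<subseteq> S) \<Longrightarrow>
      disjoint_family_on (\<lambda>i. {l i<..<u i}) {..<n} \<Longrightarrow> (\<Sum>i<n. u i - l i) < \<delta> \<Longrightarrow>
      (\<Sum>i<n. \<bar>f (u i) - f (l i)\<bar>) < \<epsilon>"
    using ac \<open>\<epsilon> > 0\<close> unfolding absolutely_continuous_on_def by meson
  have "(\<Sum>i\<in>I. \<bar>f (u i) - f (l i)\<bar>) < \<epsilon>"
    if fin: "finite I" and lu: "\<And>i. i \<in> I \<Longrightarrow> l i \<le> u i" "\<And>i. i \<in> I \<Longrightarrow> {l i..u i} \<subseteq> S"
      and dis: "disjoint_family_on (\<lambda>i. {l i<..<u i}) I" and len: "(\<Sum>i\<in>I. u i - l i) < \<delta>"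
    for I :: "'i set" and l u
  proof -
    define J where "J = {i\<in>I. l i < u i}"
    have "finite J" using fin by (simp add: J_def)
    then obtain h where h: "bij_betw h {..<card J} J"
      using ex_bij_betw_nat_finite by (metis atLeast0LessThan)
    have hJ: "h i \<in> J" if "i < card J" for i
      using h that by (auto simp: bij_betw_def)
    have "(\<Sum>i<card J. \<bar>f (u (h i)) - f (l (h i))\<bar>) < \<epsilon>"
    proof (rule \<delta>)
      show "\<forall>i<card J. l (h i) < u (h i) \<and> {l (h i)..u (h i)} \<subseteq> S"
        using hJ lu by (auto simp: J_def)
      show "disjoint_family_on (\<lambda>i. {l (h i)<..<u (h i)}) {..<card J}"
        unfolding disjoint_family_on_def
      proof (intro ballI impI)
        fix i j assume ij: "i \<in> {..<card J}" "j \<in> {..<card J}" "i \<noteq> j"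
        then have "h i \<in> I" "h j \<in> I" "h i \<noteq> h j"
          using h hJ by (auto simp: bij_betw_def inj_on_def J_def)
        then show "{l (h i)<..<u (h i)} \<inter> {l (h j)<..<u (h j)} = {}"
          using dis unfolding disjoint_family_on_def by blast
      qed
      have "(\<Sum>i<card J. u (h i) - l (h i)) = (\<Sum>i\<in>J. u i - l i)"
        by (rule sum.reindex_bij_betw[OF h])
      also have "\<dots> = (\<Sum>i\<in>I. u i - l i)"
        using fin lu by (intro sum.mono_neutral_left) (force simp: J_def)+
      finally show "(\<Sum>i<card J. u (h i) - l (h i)) < \<delta>" using len by simp
    qed
    also have "(\<Sum>i<card J. \<bar>f (u (h i)) - f (l (h i))\<bar>) = (\<Sum>i\<in>J. \<bar>f (u i) - f (l i)\<bar>)"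
      by (rule sum.reindex_bij_betw[OF h])
    also have "\<dots> = (\<Sum>i\<in>I. \<bar>f (u i) - f (l i)\<bar>)"
    proof (rule sum.mono_neutral_left[OF fin])
      show "\<forall>i\<in>I - J. \<bar>f (u i) - f (l i)\<bar> = 0"
        using lu by (force simp: J_def)
    qed (auto simp: J_def)
    finally show ?thesis .
  qed
  with \<open>\<delta> > 0\<close> show thesis by (rule that)
qed

lemma absolutely_continuous_on_imp_continuous_on:
  assumes ac: "absolutely_continuous_on {a..b} f"
  shows "continuous_on {a..b} f"
  unfolding continuous_on_iff
proof safe
  fix x \<epsilon> :: real
  assume x: "x \<in> {a..b}" and "\<epsilon> > 0"
  obtain \<delta> where "\<delta> > 0" and \<delta>: "\<And>(I::unit set) l u. finite I \<Longrightarrow>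
      (\<And>i. i \<in> I \<Longrightarrow> l i \<le> u i) \<Longrightarrow> (\<And>i. i \<in> I \<Longrightarrow> {l i..u i} \<subseteq> {a..b}) \<Longrightarrow>
      disjoint_family_on (\<lambda>i. {l i<..<u i}) I \<Longrightarrow>
      (\<Sum>i\<in>I. u i - l i) < \<delta> \<Longrightarrow> (\<Sum>i\<in>I. \<bar>f (u i) - f (l i)\<bar>) < \<epsilon>"
    by (fact absolutely_continuous_on_finite_family[OF ac \<open>\<epsilon> > 0\<close>])
  have "dist (f y) (f x) < \<epsilon>" if "y \<in> {a..b}" "dist y x < \<delta>" for y
    using \<delta>[of "{()}" "\<lambda>_. min x y" "\<lambda>_. max x y"] x that
    by (cases "x \<le> y") (auto simp: disjoint_family_on_def dist_real_def abs_minus_commute)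
  then show "\<exists>d>0. \<forall>y\<in>{a..b}. dist y x < d \<longrightarrow> dist (f y) (f x) < \<epsilon>"
    using \<open>\<delta> > 0\<close> by blast
qed

lemma absolutely_continuous_on_diff:
  assumes f: "absolutely_continuous_on S f" and g: "absolutely_continuous_on S g"
  shows "absolutely_continuous_on S (\<lambda>x. f x - g x)"
  unfolding absolutely_continuous_on_def
proof (intro allI impI)
  fix \<epsilon> :: real assume "\<epsilon> > 0"
  obtain d where "d > 0" and d: "\<And>(I::nat set) l u. finite I \<Longrightarrow>
      (\<And>i. i \<in> I \<Longrightarrow> l i \<le> u i) \<Longrightarrow> (\<And>i. i \<in> I \<Longrightarrow> {l i..u i} \<subseteq> S) \<Longrightarrow>
      disjoint_family_on (\<lambda>i. {l i<..<u i}) I \<Longrightarrow> (\<Sum>i\<in>I. u i - l i) < d \<Longrightarrow>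
      (\<Sum>i\<in>I. \<bar>f (u i) - f (l i)\<bar>) < \<epsilon>/2"
    by (fact absolutely_continuous_on_finite_family[OF f half_gt_zero[OF \<open>\<epsilon> > 0\<close>]])
  obtain e where "e > 0" and e: "\<And>(I::nat set) l u. finite I \<Longrightarrow>
      (\<And>i. i \<in> I \<Longrightarrow> l i \<le> u i) \<Longrightarrow> (\<And>i. i \<in> I \<Longrightarrow> {l i..u i} \<subseteq> S) \<Longrightarrow>
      disjoint_family_on (\<lambda>i. {l i<..<u i}) I \<Longrightarrow> (\<Sum>i\<in>I. u i - l i) < e \<Longrightarrow>
      (\<Sum>i\<in>I. \<bar>g (u i) - g (l i)\<bar>) < \<epsilon>/2"
    by (fact absolutely_continuous_on_finite_family[OF g half_gt_zero[OF \<open>\<epsilon> > 0\<close>]])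
  show "\<exists>\<delta>>0. \<forall>(n::nat) l u. (\<forall>i<n. l i < u i \<and> {l i..u i} \<subseteq> S) \<longrightarrow>
      disjoint_family_on (\<lambda>i. {l i<..<u i}) {..<n} \<longrightarrow> (\<Sum>i<n. u i - l i) < \<delta> \<longrightarrow>
      (\<Sum>i<n. \<bar>f (u i) - g (u i) - (f (l i) - g (l i))\<bar>) < \<epsilon>"
  proof (intro exI[of _ "min d e"] conjI allI impI)
    fix n :: nat and l u :: "nat \<Rightarrow> real"
    assume lu: "\<forall>i<n. l i < u i \<and> {l i..u i} \<subseteq> S" "disjoint_family_on (\<lambda>i. {l i<..<u i}) {..<n}"
      "(\<Sum>i<n. u i - l i) < min d e"
    have "(\<Sum>i<n. \<bar>f (u i) - f (l i)\<bar>) < \<epsilon>/2"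
      using lu by (intro d) (auto simp: less_imp_le)
    moreover have "(\<Sum>i<n. \<bar>g (u i) - g (l i)\<bar>) < \<epsilon>/2"
      using lu by (intro e) (auto simp: less_imp_le)
    moreover have "(\<Sum>i<n. \<bar>f (u i) - g (u i) - (f (l i) - g (l i))\<bar>)
        \<le> (\<Sum>i<n. \<bar>f (u i) - f (l i)\<bar> + \<bar>g (u i) - g (l i)\<bar>)"
      by (intro sum_mono) linarith
    ultimately show "(\<Sum>i<n. \<bar>f (u i) - g (u i) - (f (l i) - g (l i))\<bar>) < \<epsilon>"
      by (simp add: sum.distrib)
  qed (use \<open>d > 0\<close> \<open>e > 0\<close> in auto)
qed

section \<open>Positive variation and Jordan decomposition\<close>

text \<open>
  A packing of \<open>[a, b]\<close> need not cover it. Together with the admission of degenerate intervals this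
  lets a packing be cut at a point interval by interval, without changing the number of intervals.
\<close>

definition packing :: "real \<Rightarrow> real \<Rightarrow> nat \<Rightarrow> (nat \<Rightarrow> real) \<Rightarrow> (nat \<Rightarrow> real) \<Rightarrow> bool" where
  "packing a b n l u \<longleftrightarrow> (\<forall>i<n. a \<le> l i \<and> l i \<le> u i \<and> u i \<le> b) \<and>
     disjoint_family_on (\<lambda>i. {l i<..<u i}) {..<n}"

definition positive_variation :: "(real \<Rightarrow> real) \<Rightarrow> real \<Rightarrow> real \<Rightarrow> real" where
  "positive_variation f a b = Sup {\<Sum>i<n. f (u i) - f (l i) | n l u. packing a b n l u}"

lemma packing_superset:
  "packing a b n l u \<Longrightarrow> a' \<le> a \<Longrightarrow> b \<le> b' \<Longrightarrow> packing a' b' n l u"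
  unfolding packing_def by force

lemma packing_length_le:
  assumes "packing a b n l u" "a \<le> b"
  shows "(\<Sum>i<n. u i - l i) \<le> b - a"
proof -
  have lu: "l i \<le> u i" "a \<le> l i" "u i \<le> b" if "i < n" for i
    using assms that by (auto simp: packing_def)
  have "ennreal (\<Sum>i<n. u i - l i) = (\<Sum>i<n. ennreal (u i - l i))"
    using lu by (intro sum_ennreal[symmetric]) simp
  also have "\<dots> = (\<Sum>i<n. emeasure lborel {l i<..<u i})"
    using lu by (intro sum.cong) auto
  also have "\<dots> = emeasure lborel (\<Union>i<n. {l i<..<u i})"
    using assms by (intro sum_emeasure) (auto simp: packing_def)
  also have "\<dots> \<le> emeasure lborel {a..b}"
    using lu by (intro emeasure_mono) force+
  also have "\<dots> = ennreal (b - a)"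
    using \<open>a \<le> b\<close> by simp
  finally show ?thesis using \<open>a \<le> b\<close> by (simp add: ennreal_le_iff)
qed

lemma packing_clip_left:
  assumes "packing a b n l u" "a \<le> c"
  shows "packing a c n (\<lambda>i. min (l i) c) (\<lambda>i. min (u i) c)"
proof -
  have "{min (l i) c<..<min (u i) c} \<subseteq> {l i<..<u i}" for i by auto
  then have "disjoint_family_on (\<lambda>i. {min (l i) c<..<min (u i) c}) {..<n}"
    using assms(1) unfolding packing_def disjoint_family_on_def by blast
  then show ?thesis using assms by (auto simp: packing_def)
qed

lemma packing_clip_right:
  assumes "packing a b n l u" "c \<le> b"
  shows "packing c b n (\<lambda>i. max (l i) c) (\<lambda>i. max (u i) c)"
proof -
  have "{max (l i) c<..<max (u i) c} \<subseteq> {l i<..<u i}" for i by auto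
  then have "disjoint_family_on (\<lambda>i. {max (l i) c<..<max (u i) c}) {..<n}"
    using assms(1) unfolding packing_def disjoint_family_on_def by blast
  then show ?thesis using assms by (auto simp: packing_def)
qed

text \<open>
  Whether an interval lies to the left of the cut, to the right of it or across it, its increment is
  the sum of the increments of its two clipped halves. This identity makes the variation additive.
\<close>

lemma packing_clip_sum:
  fixes f :: "real \<Rightarrow> real"
  assumes "packing a b n l u"
  shows "(\<Sum>i<n. f (u i) - f (l i)) = (\<Sum>i<n. f (min (u i) c) - f (min (l i) c)) +
           (\<Sum>i<n. f (max (u i) c) - f (max (l i) c))"
  unfolding sum.distrib[symmetric] by (intro sum.cong) (auto simp: min_def max_def)

text \<open>
  Absolutely continuous functions have bounded variation: on any interval shorter than the \<open>\<delta>\<close> that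
  belongs to \<open>\<epsilon> = 1\<close>, all packing sums are at most 1, and \<open>[a, b]\<close> is cut into finitely many of these.
\<close>

lemma packing_sums_bounded:
  assumes ac: "absolutely_continuous_on {a..b} f"
  shows "\<exists>B. \<forall>n l u. packing a b n l u \<longrightarrow> (\<Sum>i<n. f (u i) - f (l i)) \<le> B"
proof -
  obtain \<delta> where "\<delta> > 0" and \<delta>: "\<And>(I::nat set) l u. finite I \<Longrightarrow>
      (\<And>i. i \<in> I \<Longrightarrow> l i \<le> u i) \<Longrightarrow> (\<And>i. i \<in> I \<Longrightarrow> {l i..u i} \<subseteq> {a..b}) \<Longrightarrow>
      disjoint_family_on (\<lambda>i. {l i<..<u i}) I \<Longrightarrow>
      (\<Sum>i\<in>I. u i - l i) < \<delta> \<Longrightarrow> (\<Sum>i\<in>I. \<bar>f (u i) - f (l i)\<bar>) < 1"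
    by (fact absolutely_continuous_on_finite_family[OF ac zero_less_one])
  have short: "(\<Sum>i<n. f (u i) - f (l i)) \<le> 1"
    if "packing c d n l u" "a \<le> c" "c \<le> d" "d \<le> b" "d - c < \<delta>" for c d n l u
  proof -
    have "(\<Sum>i<n. f (u i) - f (l i)) \<le> (\<Sum>i<n. \<bar>f (u i) - f (l i)\<bar>)"
      by (intro sum_mono) auto
    also have "\<dots> < 1"
    proof (rule \<delta>)
      fix i assume "i \<in> {..<n}"
      then have "c \<le> l i \<and> l i \<le> u i \<and> u i \<le> d" using that(1) by (simp add: packing_def)
      then show "l i \<le> u i" "{l i..u i} \<subseteq> {a..b}" using that by auto
    qed (use that packing_length_le[OF that(1,3)] in \<open>auto simp: packing_def\<close>)
    finally show ?thesis by simp
  qed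
  have "(\<Sum>i<n. f (u i) - f (l i)) \<le> real N + 1"
    if "packing a c n l u" "a \<le> c" "c \<le> b" "c - a \<le> real N * (\<delta>/2)" for c n l u N
    using that
  proof (induction N arbitrary: c n l u)
    case 0
    then show ?case using short[OF 0(1)] \<open>\<delta> > 0\<close> by simp
  next
    case (Suc N)
    \<comment> \<open>cut off a last piece of length at most \<open>\<delta>/2\<close>\<close>
    define d where "d = max a (c - \<delta>/2)"
    have "c - \<delta>/2 - a \<le> real N * (\<delta>/2)" "0 \<le> real N * (\<delta>/2)"
      using Suc.prems(4) \<open>\<delta> > 0\<close> by (simp_all add: algebra_simps)
    then have d: "a \<le> d" "d \<le> c" "c - d < \<delta>" "d - a \<le> real N * (\<delta>/2)"
      using Suc.prems(2) \<open>\<delta> > 0\<close> unfolding d_def by linarith+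
    have "(\<Sum>i<n. f (min (u i) d) - f (min (l i) d)) \<le> real N + 1"
      using Suc.prems d by (intro Suc.IH[of d] packing_clip_left) auto
    moreover have "(\<Sum>i<n. f (max (u i) d) - f (max (l i) d)) \<le> 1"
      using Suc.prems d by (intro short[of d c] packing_clip_right) auto
    ultimately show ?case
      unfolding packing_clip_sum[OF Suc.prems(1), of f d] by simp
  qed
  note * = this
  obtain N where N: "b - a < real N * (\<delta>/2)"
    using ex_less_of_nat_mult[of "\<delta>/2" "b - a"] \<open>\<delta> > 0\<close> by auto
  have "(\<Sum>i<n. f (u i) - f (l i)) \<le> real N + 1" if p: "packing a b n l u" for n l u
  proof (cases "a \<le> b")
    case True
    with *[OF p] N show ?thesis by simp
  next
    case False
    have "n = 0"
    proof (rule ccontr)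
      assume "n \<noteq> 0"
      then have "a \<le> l 0 \<and> l 0 \<le> u 0 \<and> u 0 \<le> b" using p by (auto simp: packing_def)
      with False show False by simp
    qed
    then show ?thesis by simp
  qed
  then show ?thesis by blast
qed

context
  fixes f :: "real \<Rightarrow> real" and a b :: real
  assumes ac: "absolutely_continuous_on {a..b} f"
begin

lemma packing_sum_le_positive_variation:
  assumes "packing c d n l u" "a \<le> c" "d \<le> b"
  shows "(\<Sum>i<n. f (u i) - f (l i)) \<le> positive_variation f c d"
proof -
  obtain B where "\<And>n l u. packing a b n l u \<Longrightarrow> (\<Sum>i<n. f (u i) - f (l i)) \<le> B"
    using packing_sums_bounded[OF ac] by blast
  then have "bdd_above {\<Sum>i<n. f (u i) - f (l i) | n l u. packing c d n l u}"
    using packing_superset assms(2,3) by (intro bdd_aboveI[of _ B]) blast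
  then show ?thesis
    unfolding positive_variation_def using assms(1) by (intro cSup_upper) auto
qed

lemma positive_variation_least:
  assumes "\<And>n l u. packing c d n l u \<Longrightarrow> (\<Sum>i<n. f (u i) - f (l i)) \<le> B"
  shows "positive_variation f c d \<le> B"
proof -
  have "packing c d 0 (\<lambda>_. 0) (\<lambda>_. 0)" by (simp add: packing_def disjoint_family_on_def)
  then show ?thesis
    unfolding positive_variation_def using assms by (intro cSup_least) blast+
qed

lemma positive_variation_approx:
  assumes "\<eta> > 0"
  obtains n l u where "packing c d n l u" "positive_variation f c d - \<eta> < (\<Sum>i<n. f (u i) - f (l i))"
proof -
  have "\<exists>n l u. packing c d n l u \<and> positive_variation f c d - \<eta> < (\<Sum>i<n. f (u i) - f (l i))"
  proof (rule ccontr)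
    assume "\<not> ?thesis"
    then have "positive_variation f c d \<le> positive_variation f c d - \<eta>"
      by (intro positive_variation_least) (blast intro: leI)
    with assms show False by simp
  qed
  with that show thesis by blast
qed

lemma positive_variation_mono:
  assumes "x \<le> y" "y \<le> b"
  shows "positive_variation f a x \<le> positive_variation f a y"
  using assms packing_superset[of a x _ _ _ a y]
  by (intro positive_variation_least packing_sum_le_positive_variation) auto

text \<open>
  Adding the interval \<open>[x, y]\<close> to a packing of \<open>[a, x]\<close> gives a packing of \<open>[a, y]\<close>. Hence the positive
  variation exceeds \<open>f\<close> by a non-decreasing function.
\<close>

lemma positive_variation_increment_ge:
  assumes "a \<le> x" "x \<le> y" "y \<le> b"
  shows "f y - f x \<le> positive_variation f a y - positive_variation f a x"
proof -
  have "positive_variation f a x \<le> positive_variation f a y - (f y - f x)"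
  proof (rule positive_variation_least)
    fix n l u assume p: "packing a x n l u"
    define l' u' where "l' = l(n := x)" and "u' = u(n := y)"
    have "packing a y (Suc n) l' u'"
      unfolding packing_def
    proof
      show "\<forall>i<Suc n. a \<le> l' i \<and> l' i \<le> u' i \<and> u' i \<le> y"
        using p assms by (fastforce simp: packing_def l'_def u'_def less_Suc_eq)
      have disj: "{l i<..<u i} \<inter> {x<..<y} = {}" if "i < n" for i
      proof -
        have "u i \<le> x" using p that by (simp add: packing_def)
        then show ?thesis by auto
      qed
      show "disjoint_family_on (\<lambda>i. {l' i<..<u' i}) {..<Suc n}"
        unfolding disjoint_family_on_def
      proof (intro ballI impI)
        fix i j assume "i \<in> {..<Suc n}" "j \<in> {..<Suc n}" "i \<noteq> j"
        then consider "i < n" "j < n" | "i < n" "j = n" | "i = n" "j < n" by fastforce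
        then show "{l' i<..<u' i} \<inter> {l' j<..<u' j} = {}"
        proof cases
          case 1
          then show ?thesis using p \<open>i \<noteq> j\<close>
            by (simp add: l'_def u'_def packing_def disjoint_family_on_def del: Int_greaterThanLessThan)
        next
          case 2 with disj[of i] show ?thesis by (simp add: l'_def u'_def del: Int_greaterThanLessThan)
        next
          case 3 with disj[of j] show ?thesis
            by (simp add: l'_def u'_def Int_commute del: Int_greaterThanLessThan)
        qed
      qed
    qed
    from packing_sum_le_positive_variation[OF this order_refl assms(3)]
    show "(\<Sum>i<n. f (u i) - f (l i)) \<le> positive_variation f a y - (f y - f x)"
      by (simp add: l'_def u'_def)
  qed
  then show ?thesis by simp
qed

lemma positive_variation_increment_le:
  assumes "a \<le> x" "x \<le> y" "y \<le> b"
  shows "positive_variation f a y - positive_variation f a x \<le> positive_variation f x y"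
proof -
  have "positive_variation f a y \<le> positive_variation f a x + positive_variation f x y"
  proof (rule positive_variation_least)
    fix n l u assume p: "packing a y n l u"
    show "(\<Sum>i<n. f (u i) - f (l i)) \<le> positive_variation f a x + positive_variation f x y"
      unfolding packing_clip_sum[OF p, of f x] using p assms
      by (intro add_mono packing_sum_le_positive_variation packing_clip_left packing_clip_right) auto
  qed
  then show ?thesis by simp
qed

text \<open>
  The increment of the positive variation over each interval \<open>[l i, u i]\<close> of a short family is nearly a
  packing sum in that interval. All these packings together form one family that is as short as the
  given one, so the absolute continuity of \<open>f\<close> bounds the total.
\<close>

lemma absolutely_continuous_positive_variation:
  "absolutely_continuous_on {a..b} (positive_variation f a)"
  unfolding absolutely_continuous_on_def
proof (intro allI impI)
  fix \<epsilon> :: real assume "\<epsilon> > 0"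
  obtain \<delta> where "\<delta> > 0" and \<delta>: "\<And>(I::(nat \<times> nat) set) l u. finite I \<Longrightarrow>
      (\<And>i. i \<in> I \<Longrightarrow> l i \<le> u i) \<Longrightarrow> (\<And>i. i \<in> I \<Longrightarrow> {l i..u i} \<subseteq> {a..b}) \<Longrightarrow>
      disjoint_family_on (\<lambda>i. {l i<..<u i}) I \<Longrightarrow>
      (\<Sum>i\<in>I. u i - l i) < \<delta> \<Longrightarrow> (\<Sum>i\<in>I. \<bar>f (u i) - f (l i)\<bar>) < \<epsilon>/2"
    by (fact absolutely_continuous_on_finite_family[OF ac half_gt_zero[OF \<open>\<epsilon> > 0\<close>]])
  have "(\<Sum>i<n. \<bar>positive_variation f a (u i) - positive_variation f a (l i)\<bar>) < \<epsilon>"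
    if lu: "\<forall>i<n. l i < u i \<and> {l i..u i} \<subseteq> {a..b}"
      and dis: "disjoint_family_on (\<lambda>i. {l i<..<u i}) {..<n}" and len: "(\<Sum>i<n. u i - l i) < \<delta>"
    for n :: nat and l u
  proof -
    \<comment> \<open>the errors of the \<open>n\<close> approximations then add up to at most \<open>\<epsilon>/2\<close>\<close>
    define \<eta> where "\<eta> = \<epsilon> / (2 * (real n + 1))"
    have "\<eta> > 0" using \<open>\<epsilon> > 0\<close> by (simp add: \<eta>_def)
    have "\<forall>i. \<exists>m L U. packing (l i) (u i) m L U \<and>
        positive_variation f (l i) (u i) - \<eta> < (\<Sum>j<m. f (U j) - f (L j))"
      using positive_variation_approx[OF \<open>\<eta> > 0\<close>] by metis
    then obtain m L U where p: "\<And>i. packing (l i) (u i) (m i) (L i) (U i)"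
      and approx: "\<And>i. positive_variation f (l i) (u i) - \<eta> < (\<Sum>j<m i. f (U i j) - f (L i j))"
      by metis
    have ab: "a \<le> l i" "l i < u i" "u i \<le> b" if "i < n" for i
    proof -
      have "l i < u i" "{l i..u i} \<subseteq> {a..b}" using lu that by auto
      then show "a \<le> l i" "l i < u i" "u i \<le> b" by auto
    qed
    have LU: "l i \<le> L i j" "L i j \<le> U i j" "U i j \<le> u i" if "i < n" "j < m i" for i j
      using p[of i] that by (auto simp: packing_def)
    define J where "J = (SIGMA i:{..<n}. {..<m i})"
    have "finite J" by (simp add: J_def)
    have "(\<Sum>p\<in>J. \<bar>f (case_prod U p) - f (case_prod L p)\<bar>) < \<epsilon>/2"
    proof (rule \<delta>[OF \<open>finite J\<close>])
      fix p assume "p \<in> J"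
      then obtain i j where ij: "p = (i, j)" "i < n" "j < m i" by (auto simp: J_def)
      show "case_prod L p \<le> case_prod U p" "{case_prod L p..case_prod U p} \<subseteq> {a..b}"
        using LU[OF ij(2,3)] ab[OF ij(2)] ij(1) by auto
    next
      show "disjoint_family_on (\<lambda>p. {case_prod L p<..<case_prod U p}) J"
        unfolding disjoint_family_on_def
      proof (intro ballI impI)
        fix p q assume pq: "p \<in> J" "q \<in> J" "p \<noteq> q"
        obtain i j i' j' where ij: "p = (i, j)" "q = (i', j')" by fastforce
        have mem: "i < n" "j < m i" "i' < n" "j' < m i'" using pq ij by (auto simp: J_def)
        show "{case_prod L p<..<case_prod U p} \<inter> {case_prod L q<..<case_prod U q} = {}"
        proof (cases "i = i'")
          case True
          then show ?thesis
            using p[of i] pq ij mem unfolding packing_def disjoint_family_on_def by auto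
        next
          case False
          then have "{l i<..<u i} \<inter> {l i'<..<u i'} = {}"
            using dis mem unfolding disjoint_family_on_def by auto
          moreover have "{L i j<..<U i j} \<subseteq> {l i<..<u i}" "{L i' j'<..<U i' j'} \<subseteq> {l i'<..<u i'}"
            using LU[OF mem(1,2)] LU[OF mem(3,4)] by auto
          ultimately show ?thesis unfolding ij prod.case by blast
        qed
      qed
      have "(\<Sum>p\<in>J. case_prod U p - case_prod L p) = (\<Sum>i<n. \<Sum>j<m i. U i j - L i j)"
        unfolding J_def by (simp add: sum.Sigma split_def)
      also have "\<dots> \<le> (\<Sum>i<n. u i - l i)"
        using ab by (intro sum_mono packing_length_le[OF p]) (simp add: less_imp_le)
      finally show "(\<Sum>p\<in>J. case_prod U p - case_prod L p) < \<delta>" using len by simp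
    qed
    moreover have "(\<Sum>i<n. \<Sum>j<m i. f (U i j) - f (L i j)) = (\<Sum>p\<in>J. f (case_prod U p) - f (case_prod L p))"
      unfolding J_def by (simp add: sum.Sigma split_def)
    moreover have "\<dots> \<le> (\<Sum>p\<in>J. \<bar>f (case_prod U p) - f (case_prod L p)\<bar>)"
      by (intro sum_mono) auto
    moreover have "(\<Sum>i<n. \<bar>positive_variation f a (u i) - positive_variation f a (l i)\<bar>)
        \<le> (\<Sum>i<n. (\<Sum>j<m i. f (U i j) - f (L i j)) + \<eta>)"
    proof (rule sum_mono)
      fix i assume "i \<in> {..<n}"
      then have i: "i < n" by simp
      show "\<bar>positive_variation f a (u i) - positive_variation f a (l i)\<bar> \<le> (\<Sum>j<m i. f (U i j) - f (L i j)) + \<eta>"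
        using positive_variation_mono[of "l i" "u i"] positive_variation_increment_le[of "l i" "u i"]
          approx[of i] ab[OF i] by simp
    qed
    moreover have "(\<Sum>i<n. (\<Sum>j<m i. f (U i j) - f (L i j)) + \<eta>)
        = (\<Sum>i<n. \<Sum>j<m i. f (U i j) - f (L i j)) + real n * \<eta>"
      by (simp add: sum.distrib)
    moreover have "real n * \<eta> \<le> \<epsilon>/2"
      using \<open>\<epsilon> > 0\<close> by (simp add: \<eta>_def field_simps)
    ultimately show ?thesis by linarith
  qed
  then show "\<exists>\<delta>>0. \<forall>(n::nat) l u. (\<forall>i<n. l i < u i \<and> {l i..u i} \<subseteq> {a..b}) \<longrightarrow>
      disjoint_family_on (\<lambda>i. {l i<..<u i}) {..<n} \<longrightarrow> (\<Sum>i<n. u i - l i) < \<delta> \<longrightarrow>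
      (\<Sum>i<n. \<bar>positive_variation f a (u i) - positive_variation f a (l i)\<bar>) < \<epsilon>"
    using \<open>\<delta> > 0\<close> by blast
qed

proposition absolutely_continuous_on_Jordan_decomposition:
  obtains p q where "absolutely_continuous_on {a..b} p" "absolutely_continuous_on {a..b} q"
    "mono_on {a..b} p" "mono_on {a..b} q" "\<And>x. f x = p x - q x"
proof
  show "absolutely_continuous_on {a..b} (positive_variation f a)"
    by (rule absolutely_continuous_positive_variation)
  show "absolutely_continuous_on {a..b} (\<lambda>x. positive_variation f a x - f x)"
    by (intro absolutely_continuous_on_diff absolutely_continuous_positive_variation ac)
  show "mono_on {a..b} (positive_variation f a)"
    using positive_variation_mono by (auto simp: mono_on_def)
  show "mono_on {a..b} (\<lambda>x. positive_variation f a x - f x)"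
    using positive_variation_increment_ge by (force simp: mono_on_def)
qed simp

end

section \<open>Densities of non-decreasing functions\<close>

lemma division_of_real_interval:
  fixes S :: "real set"
  assumes D: "\<D> division_of S" and K: "K \<in> \<D>"
  shows "K = {Inf K..Sup K}" "Inf K \<le> Sup K" "interior K = {Inf K<..<Sup K}"
proof -
  obtain c d where "K = cbox c d" "K \<noteq> {}"
    using division_ofD(3,4)[OF D K] by blast
  then have "K = {c..d}" "c \<le> d" by (auto simp: cbox_interval)
  then show "K = {Inf K..Sup K}" "Inf K \<le> Sup K" "interior K = {Inf K<..<Sup K}"
    by (simp_all add: interior_atLeastAtMost_real)
qed

lemma emeasure_elementary_le_division_sum:
  assumes D: "\<D> division_of S" and M: "sets M = sets borel"
    and Icc: "\<And>c d::real. c \<le> d \<Longrightarrow> emeasure M {c..d} = ennreal (G d - G c)"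
    and G: "\<And>c d. c \<le> d \<Longrightarrow> G c \<le> G d"
  shows "emeasure M S \<le> ennreal (\<Sum>K\<in>\<D>. G (Sup K) - G (Inf K))"
proof -
  note K = division_of_real_interval[OF D]
  have "S = (\<Union>K\<in>\<D>. K)" using division_ofD(6)[OF D] by simp
  moreover have "K \<in> sets M" if "K \<in> \<D>" for K
    by (subst K(1)[OF that]) (simp add: M)
  ultimately have "emeasure M S \<le> (\<Sum>K\<in>\<D>. emeasure M K)"
    using emeasure_subadditive_finite[of \<D> "\<lambda>K. K" M] division_ofD(1)[OF D] by auto
  also have "\<dots> = (\<Sum>K\<in>\<D>. ennreal (G (Sup K) - G (Inf K)))"
    using K(1,2) Icc by (intro sum.cong) metis+
  also have "\<dots> = ennreal (\<Sum>K\<in>\<D>. G (Sup K) - G (Inf K))"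
    using K(2) G by (intro sum_ennreal) simp
  finally show ?thesis .
qed

text \<open>
  A Lebesgue null set lies in an open set of measure less than \<open>\<delta>\<close>, which is an increasing union of
  finite unions of compact intervals. Dividing such a finite union into non-overlapping intervals turns
  the absolute continuity of \<open>F\<close> into the bound \<open>\<epsilon>\<close> for its Stieltjes measure. Since that measure
  lives on the whole line, \<open>F\<close> is extended by constants to both sides of \<open>[a, b]\<close>.
\<close>

lemma absolutely_continuous_interval_measure:
  fixes F :: "real \<Rightarrow> real" and a b :: real
  defines "G \<equiv> \<lambda>x. F (max a (min b x))"
  assumes ac: "absolutely_continuous_on {a..b} F" and mono: "mono_on {a..b} F" and "a \<le> b"
  shows "absolutely_continuous lborel (interval_measure G)"
    and "a \<le> c \<Longrightarrow> c \<le> d \<Longrightarrow> d \<le> b \<Longrightarrow> emeasure (interval_measure G) {c..d} = ennreal (F d - F c)"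
proof -
  define g where "g = (\<lambda>x. max a (min b x))"
  have G_eq: "G x = F (g x)" for x by (simp add: G_def g_def)
  have gab: "g x \<in> {a..b}" for x using \<open>a \<le> b\<close> by (auto simp: g_def)
  have gmono: "g x \<le> g y" if "x \<le> y" for x y using that by (auto simp: g_def)
  \<comment> \<open>clamping shortens intervals, so that families that reach outside \<open>[a, b]\<close> stay short\<close>
  have g_contract: "g y - g x \<le> y - x" if "x \<le> y" for x y
    using that unfolding g_def by linarith
  have G_mono: "G x \<le> G y" if "x \<le> y" for x y
    using mono gab gmono[OF that] by (auto simp: G_eq mono_on_def)
  have "continuous_on UNIV g" unfolding g_def by (intro continuous_intros)
  then have "continuous_on UNIV (\<lambda>x. F (g x))"
    using gab by (intro continuous_on_compose2[OF absolutely_continuous_on_imp_continuous_on[OF ac]]) auto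
  then have G_cont: "continuous_on UNIV G" by (simp add: G_eq[abs_def])
  define M where "M = interval_measure G"
  have setsM: "sets M = sets borel" by (simp add: M_def)
  have Icc: "emeasure M {c..d} = ennreal (G d - G c)" if "c \<le> d" for c d
    unfolding M_def by (rule emeasure_interval_measure_Icc[OF that G_mono G_cont])
  have "emeasure M N = 0" if N: "N \<in> null_sets lborel" for N
  proof -
    have "emeasure M N \<le> ennreal \<epsilon>" if "\<epsilon> > 0" for \<epsilon>
    proof -
      obtain \<delta> where "\<delta> > 0" and \<delta>: "\<And>(I::real set set) l u. finite I \<Longrightarrow>
          (\<And>i. i \<in> I \<Longrightarrow> l i \<le> u i) \<Longrightarrow> (\<And>i. i \<in> I \<Longrightarrow> {l i..u i} \<subseteq> {a..b}) \<Longrightarrow>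
          disjoint_family_on (\<lambda>i. {l i<..<u i}) I \<Longrightarrow> (\<Sum>i\<in>I. u i - l i) < \<delta> \<Longrightarrow>
          (\<Sum>i\<in>I. \<bar>F (u i) - F (l i)\<bar>) < \<epsilon>"
        by (fact absolutely_continuous_on_finite_family[OF ac \<open>\<epsilon> > 0\<close>])
      have "N \<in> sets borel" using N by (auto simp: null_sets_def)
      then obtain U where U: "open U" "N \<subseteq> U" "emeasure lborel (U - N) < ennreal \<delta>"
        using outer_regular_lborel[of N \<delta>] \<open>\<delta> > 0\<close> by blast
      have Ulen: "emeasure lborel U < ennreal \<delta>"
      proof -
        have "emeasure lborel U = emeasure lborel (U - N)"
          using N \<open>open U\<close> by (intro emeasure_Diff_null_set[symmetric]) auto
        with U(3) show ?thesis by simp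
      qed
      obtain \<C> where \<C>: "countable \<C>" "\<C> \<subseteq> Pow U" "\<And>X. X \<in> \<C> \<Longrightarrow> \<exists>a b. X = cbox a b" "\<Union>\<C> = U"
        using open_countable_Union_open_cbox[OF \<open>open U\<close>] by metis
      have fin: "emeasure M (\<Union>\<F>) \<le> ennreal \<epsilon>" if \<F>: "finite \<F>" "\<F> \<subseteq> \<C>" for \<F>
      proof -
        obtain \<D> where \<D>: "\<D> division_of \<Union>\<F>"
          using elementary_unions_intervals[OF \<F>(1)] \<F>(2) \<C>(3) by blast
        note K = division_of_real_interval[OF \<D>]
        have "(\<Sum>K\<in>\<D>. g (Sup K) - g (Inf K)) \<le> (\<Sum>K\<in>\<D>. Sup K - Inf K)"
          using K(2) by (intro sum_mono) (simp add: g_contract)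
        also have "\<dots> < \<delta>"
        proof -
          have "ennreal (\<Sum>K\<in>\<D>. Sup K - Inf K) = (\<Sum>K\<in>\<D>. ennreal (Sup K - Inf K))"
            using K(2) by (intro sum_ennreal[symmetric]) simp
          also have "\<dots> = (\<Sum>K\<in>\<D>. emeasure lborel (interior K))"
            using K(2,3) by (intro sum.cong) simp_all
          also have "\<dots> = emeasure lborel (\<Union>K\<in>\<D>. interior K)"
            using division_ofD(1,5)[OF \<D>]
            by (intro sum_emeasure) (auto simp: disjoint_family_on_def)
          also have "\<dots> \<le> emeasure lborel U"
          proof (rule emeasure_mono)
            have "(\<Union>K\<in>\<D>. interior K) \<subseteq> \<Union>\<D>" using interior_subset by blast
            also have "\<dots> \<subseteq> U" using division_ofD(6)[OF \<D>] \<F>(2) \<C>(2) by blast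
            finally show "(\<Union>K\<in>\<D>. interior K) \<subseteq> U" .
          qed (use \<open>open U\<close> in auto)
          also have "\<dots> < ennreal \<delta>" by (rule Ulen)
          finally show ?thesis using \<open>\<delta> > 0\<close> by (simp add: ennreal_less_iff sum_nonneg K(2))
        qed
        finally have len: "(\<Sum>K\<in>\<D>. g (Sup K) - g (Inf K)) < \<delta>" .
        have "(\<Sum>K\<in>\<D>. \<bar>F (g (Sup K)) - F (g (Inf K))\<bar>) < \<epsilon>"
        proof (rule \<delta>)
          show "finite \<D>" using \<D> by blast
          show "disjoint_family_on (\<lambda>K. {g (Inf K)<..<g (Sup K)}) \<D>"
            unfolding disjoint_family_on_def
          proof (intro ballI impI)
            fix K L assume KL: "K \<in> \<D>" "L \<in> \<D>" "K \<noteq> L"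
            have sub: "{g (Inf K)<..<g (Sup K)} \<subseteq> interior K" if "K \<in> \<D>" for K
              unfolding K(3)[OF that] by (auto simp: g_def)
            show "{g (Inf K)<..<g (Sup K)} \<inter> {g (Inf L)<..<g (Sup L)} = {}"
              using division_ofD(5)[OF \<D> KL] sub[OF KL(1)] sub[OF KL(2)] by blast
          qed
        next
          fix K assume "K \<in> \<D>"
          then show "g (Inf K) \<le> g (Sup K)" using K(2) gmono by blast
          show "{g (Inf K)..g (Sup K)} \<subseteq> {a..b}"
            using gab[of "Inf K"] gab[of "Sup K"] by auto
        qed (rule len)
        moreover have "(\<Sum>K\<in>\<D>. G (Sup K) - G (Inf K)) \<le> (\<Sum>K\<in>\<D>. \<bar>F (g (Sup K)) - F (g (Inf K))\<bar>)"
          by (intro sum_mono) (simp add: G_eq)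
        ultimately have "(\<Sum>K\<in>\<D>. G (Sup K) - G (Inf K)) \<le> \<epsilon>" by linarith
        moreover have "emeasure M (\<Union>\<F>) \<le> ennreal (\<Sum>K\<in>\<D>. G (Sup K) - G (Inf K))"
          by (intro emeasure_elementary_le_division_sum[OF \<D> setsM] Icc G_mono)
        ultimately show ?thesis by (meson ennreal_leI order_trans)
      qed
      have "emeasure M U \<le> ennreal \<epsilon>"
      proof (cases "\<C> = {}")
        case True
        then show ?thesis using \<C>(4) by auto
      next
        case False
        have "range (from_nat_into \<C>) = \<C>"
          using range_from_nat_into[OF False \<C>(1)] .
        moreover have "(\<Union>n. \<Union>i\<le>n. from_nat_into \<C> i) = \<Union>(range (from_nat_into \<C>))"
          by blast
        ultimately have Un: "U = (\<Union>n. \<Union>i\<le>n. from_nat_into \<C> i)"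
          using \<C>(4) by simp
        have C: "from_nat_into \<C> i \<in> \<C>" for i using from_nat_into[OF False] .
        have "emeasure M U = (SUP n. emeasure M (\<Union>i\<le>n. from_nat_into \<C> i))"
          unfolding Un
        proof (rule SUP_emeasure_incseq[symmetric])
          have "from_nat_into \<C> i \<in> sets M" for i
            using \<C>(3)[OF C[of i]] by (auto simp: setsM)
          then show "range (\<lambda>n. \<Union>i\<le>n. from_nat_into \<C> i) \<subseteq> sets M" by auto
          show "incseq (\<lambda>n. \<Union>i\<le>n. from_nat_into \<C> i)"
            by (force simp: incseq_def)
        qed
        also have "\<dots> \<le> ennreal \<epsilon>"
          using C by (intro SUP_least fin) auto
        finally show ?thesis .
      qed
      moreover have "emeasure M N \<le> emeasure M U"
        using U by (intro emeasure_mono) (auto simp: setsM)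
      ultimately show ?thesis by simp
    qed
    then show ?thesis
      by (metis ennreal_le_epsilon add_0 le_zero_eq)
  qed
  then have "N \<in> null_sets M" if "N \<in> null_sets lborel" for N
    using that by (auto simp: null_sets_def setsM)
  then show "absolutely_continuous lborel (interval_measure G)"
    unfolding absolutely_continuous_def M_def by auto
  show "emeasure (interval_measure G) {c..d} = ennreal (F d - F c)"
    if "a \<le> c" "c \<le> d" "d \<le> b"
    using Icc[of c d] that by (simp add: M_def G_def max_def min_def)
qed

text \<open>
  The density is the Radon-Nikodym derivative of the Stieltjes measure of \<open>F\<close> with respect to
  Lebesgue measure; that it is non-negative reflects that \<open>F\<close> is non-decreasing.
\<close>

lemma absolutely_continuous_mono_imp_indefinite_integral:
  assumes ac: "absolutely_continuous_on {a..b} F" and mono: "mono_on {a..b} F" and "a \<le> b"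
  obtains h where "\<And>x. 0 \<le> h x" "h absolutely_integrable_on {a..b}"
    "\<And>x. x \<in> {a..b} \<Longrightarrow> F x = F a + integral {a..x} h"
proof -
  define M where "M = interval_measure (\<lambda>x. F (max a (min b x)))"
  note M = absolutely_continuous_interval_measure[OF ac mono \<open>a \<le> b\<close>, folded M_def]
  obtain f where f[measurable]: "f \<in> borel_measurable lborel" and dens: "density lborel f = M"
    using sigma_finite_measure.Radon_Nikodym[OF sigma_finite_lborel M(1)] by (auto simp: M_def)
  have nn: "(\<integral>\<^sup>+t. f t * indicator {a..x} t \<partial>lborel) = ennreal (F x - F a)" if "x \<in> {a..b}" for x
    using M(2)[of a x] that dens emeasure_density[OF f, of "{a..x}"] by simp
  \<comment> \<open>multiplying by the indicator first makes the density finite almost everywhere\<close>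
  define h where "h t = enn2real (f t * indicator {a..b} t)" for t
  have hm[measurable]: "h \<in> borel_measurable lborel" unfolding h_def by measurable
  have fin: "AE t in lborel. f t * indicator {a..b} t \<noteq> \<infinity>"
    using nn[of b] \<open>a \<le> b\<close> by (intro nn_integral_PInf_AE) auto
  have hint: "(h has_integral (F x - F a)) {a..x}" if x: "x \<in> {a..b}" for x
  proof -
    have F: "F a \<le> F x" using mono x \<open>a \<le> b\<close> by (auto simp: mono_on_def)
    have "(\<integral>\<^sup>+t. ennreal (h t * indicator {a..x} t) \<partial>lborel) = (\<integral>\<^sup>+t. f t * indicator {a..x} t \<partial>lborel)"
      using fin x
      by (intro nn_integral_cong_AE) (auto elim!: eventually_mono simp: h_def indicator_def less_top)
    then have *: "(\<integral>\<^sup>+t. ennreal (h t * indicator {a..x} t) \<partial>lborel) = ennreal (F x - F a)"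
      using nn[OF x] by simp
    have "((\<lambda>t. h t * indicator {a..x} t) has_integral (F x - F a)) UNIV"
      using * F by (intro nn_integral_has_integral) (auto simp: h_def)
    moreover have "(\<lambda>t. h t * indicator {a..x} t) = (\<lambda>t. if t \<in> {a..x} then h t else 0)"
      by (auto simp: indicator_def)
    ultimately show ?thesis by (simp only: has_integral_restrict_UNIV)
  qed
  show thesis
  proof
    show "0 \<le> h x" for x by (simp add: h_def)
    then show "h absolutely_integrable_on {a..b}"
      using hint[of b] \<open>a \<le> b\<close> by (intro nonnegative_absolutely_integrable_1) auto
    show "F x = F a + integral {a..x} h" if "x \<in> {a..b}" for x
      using integral_unique[OF hint[OF that]] by simp
  qed
qed

section \<open>Indefinite integrals\<close>

text \<open>
  Averages over cubes with lower corner \<open>x\<close> converge to \<open>f x\<close> almost everywhere; on the line these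
  averages are the right difference quotients of the indefinite integral.
\<close>

lemma indefinite_integral_right_derivative:
  fixes f :: "real \<Rightarrow> real"
  assumes f: "\<And>a b. f integrable_on {a..b}"
  obtains N where "negligible N"
    "\<And>x. x \<notin> N \<Longrightarrow> ((\<lambda>h. integral {x..x + h} f / h) \<longlongrightarrow> f x) (at_right 0)"
proof -
  have "f integrable_on cbox a b" for a b using f by (simp add: cbox_interval)
  then obtain N where N: "negligible N" "\<And>x e. \<lbrakk>x \<notin> N; 0 < e\<rbrakk> \<Longrightarrow> \<exists>d>0. \<forall>h. 0 < h \<and> h < d \<longrightarrow>
      norm (integral (cbox x (x + h *\<^sub>R One)) f /\<^sub>R h ^ DIM(real) - f x) < e"
    using integrable_ccontinuous_explicit by blast
  show thesis
  proof (rule that[OF N(1)])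
    fix x assume "x \<notin> N"
    show "((\<lambda>h. integral {x..x + h} f / h) \<longlongrightarrow> f x) (at_right 0)"
      unfolding tendsto_iff
    proof (intro allI impI)
      fix e :: real assume "e > 0"
      then show "\<forall>\<^sub>F h in at_right 0. dist (integral {x..x + h} f / h) (f x) < e"
        using N(2)[OF \<open>x \<notin> N\<close> \<open>e > 0\<close>] unfolding eventually_at_right_field
        by (auto simp: dist_real_def cbox_interval divide_inverse mult.commute)
    qed
  qed
qed

text \<open>
  Lebesgue's differentiation theorem. Left difference quotients of the integral of \<open>f\<close> at \<open>x\<close> are right
  difference quotients of the integral of \<open>\<lambda>t. f (- t)\<close> at \<open>- x\<close>, so the one-sided statement is used
  twice.
\<close>

theorem indefinite_integral_has_vector_derivative_ae:
  fixes f :: "real \<Rightarrow> real"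
  assumes f: "f integrable_on {a..b}"
  obtains N where "negligible N"
    "\<And>x. x \<in> {a..b} - N \<Longrightarrow> ((\<lambda>x. integral {a..x} f) has_vector_derivative f x) (at x within {a..b})"
proof -
  define g where "g x = (if x \<in> {a..b} then f x else 0)" for x
  have "g integrable_on UNIV"
    unfolding g_def using f integrable_restrict_UNIV by blast
  then have g: "g integrable_on {c..d}" for c d
    by (rule integrable_on_subinterval) simp
  have g': "(\<lambda>x. g (- x)) integrable_on {c..d}" for c d
    using g[of "- d" "- c"] Henstock_Kurzweil_Integration.integrable_reflect_real[where f = g and a = "- d" and b = "- c"]
    by simp
  obtain N1 where N1: "negligible N1"
    "\<And>x. x \<notin> N1 \<Longrightarrow> ((\<lambda>h. integral {x..x + h} g / h) \<longlongrightarrow> g x) (at_right 0)"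
    using indefinite_integral_right_derivative[OF g] by blast
  obtain N2 where N2: "negligible N2"
    "\<And>x. x \<notin> N2 \<Longrightarrow> ((\<lambda>h. integral {x..x + h} (\<lambda>t. g (- t)) / h) \<longlongrightarrow> g (- x)) (at_right 0)"
    using indefinite_integral_right_derivative[OF g'] by blast
  \<comment> \<open>outside the two endpoints the derivative within \<open>[a, b]\<close> is the two-sided one\<close>
  define N where "N = N1 \<union> uminus ` N2 \<union> {a, b}"
  have "negligible N"
    using N1(1) N2(1) unfolding N_def
    by (intro negligible_Un negligible_differentiable_image_negligible differentiable_on_minus differentiable_on_ident) auto
  moreover have "((\<lambda>x. integral {a..x} f) has_vector_derivative f x) (at x within {a..b})"
    if "x \<in> {a..b} - N" for x
  proof -
    have x: "a < x" "x < b" "x \<notin> N1" "- x \<notin> N2"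
      using that by (auto simp: N_def image_iff)
    define Q where "Q h = (integral {a..x + h} g - integral {a..x} g) / h" for h
    have comb: "integral {a..d} g - integral {a..c} g = integral {c..d} g" if "a \<le> c" "c \<le> d" for c d
      using Henstock_Kurzweil_Integration.integral_combine[OF that g] by simp
    have "(Q \<longlongrightarrow> g x) (at_right 0)"
    proof (rule Lim_transform_eventually[OF N1(2)[OF x(3)]])
      show "\<forall>\<^sub>F h in at_right 0. integral {x..x + h} g / h = Q h"
        unfolding eventually_at_right_field using x comb by (intro exI[of _ 1]) (auto simp: Q_def)
    qed
    moreover have "(Q \<longlongrightarrow> g x) (at_left 0)"
      unfolding filterlim_at_left_to_right
    proof (rule Lim_transform_eventually)
      show "((\<lambda>h. integral {- x..- x + h} (\<lambda>t. g (- t)) / h) \<longlongrightarrow> g x) (at_right (- 0))"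
        using N2(2)[OF x(4)] by simp
      have "integral {- x..- x + h} (\<lambda>t. g (- t)) / h = Q (- h)" if "0 < h" "h < x - a" for h
        using comb[of "x - h" x] that
          Henstock_Kurzweil_Integration.integral_reflect_real[of "x" "x - h" g]
        by (simp add: Q_def field_simps)
      then show "\<forall>\<^sub>F h in at_right (- 0). integral {- x..- x + h} (\<lambda>t. g (- t)) / h = Q (- h)"
        unfolding eventually_at_right_field using x by (intro exI[of _ "x - a"]) auto
    qed
    ultimately have "(Q \<longlongrightarrow> g x) (at 0)"
      by (simp add: filterlim_split_at)
    then have "((\<lambda>x. integral {a..x} g) has_field_derivative g x) (at x)"
      unfolding DERIV_def Q_def .
    then have "((\<lambda>x. integral {a..x} g) has_vector_derivative g x) (at x within {a..b})"
      by (simp add: has_real_derivative_iff_has_vector_derivative has_vector_derivative_at_within)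
    moreover have "integral {a..y} g = integral {a..y} f" if "y \<in> {a..b}" for y
      using that by (intro integral_cong) (auto simp: g_def)
    ultimately show ?thesis
      using x by (auto simp: g_def elim!: has_vector_derivative_transform[rotated 2])
  qed
  ultimately show thesis by (rule that)
qed

text \<open>
  Truncate \<open>\<bar>f\<bar>\<close> at height \<open>k\<close>. By dominated convergence the part above \<open>k\<close> has integral less than
  \<open>\<epsilon>/2\<close> for some \<open>k\<close>, whatever the set of integration; the part below contributes at most \<open>k\<close> times
  the length of that set.
\<close>

lemma absolutely_continuous_on_indefinite_integral:
  fixes f :: "real \<Rightarrow> real"
  assumes f: "f absolutely_integrable_on {a..b}"
  shows "absolutely_continuous_on {a..b} (\<lambda>x. integral {a..x} f)"
  unfolding absolutely_continuous_on_def
proof (intro allI impI)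
  fix \<epsilon> :: real assume "\<epsilon> > 0"
  define A where "A x = \<bar>f x\<bar>" for x
  define R where "R k x = A x - min (A x) (real k)" for k x
  have Aint: "A absolutely_integrable_on {a..b}"
    unfolding A_def using absolutely_integrable_norm[OF f] by (simp add: comp_def)
  have Rabs: "R k absolutely_integrable_on {a..b}" for k
    unfolding R_def by (intro set_integral_diff absolutely_integrable_min_1 Aint) auto
  have Rnn: "0 \<le> R k x" for k x by (simp add: R_def)
  have RA: "A x \<le> R k x + real k" for k x by (simp add: R_def)
  have "(\<lambda>k. integral {a..b} (R k)) \<longlonglongrightarrow> integral {a..b} (\<lambda>x. 0)"
  proof (rule dominated_convergence)
    show "R k integrable_on {a..b}" for k
      using Rabs absolutely_integrable_on_def by blast
    show "A integrable_on {a..b}" using Aint absolutely_integrable_on_def by blast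
    show "norm (R k x) \<le> A x" for k x by (auto simp: R_def A_def)
    show "(\<lambda>k. R k x) \<longlonglongrightarrow> 0" for x
    proof (rule tendsto_eventually)
      obtain m where "A x \<le> real m" using real_arch_simple by blast
      then show "\<forall>\<^sub>F k in sequentially. R k x = 0"
        unfolding eventually_sequentially R_def by (intro exI[of _ m]) force
    qed
  qed
  then have "\<forall>\<^sub>F k in sequentially. integral {a..b} (R k) < \<epsilon>/2"
    using \<open>\<epsilon> > 0\<close> by (intro order_tendstoD(2)) auto
  then obtain k where k: "integral {a..b} (R k) < \<epsilon>/2"
    by (meson eventually_happens sequentially_bot)
  define \<delta> where "\<delta> = \<epsilon> / (2 * (real k + 1))"
  have "\<delta> > 0" using \<open>\<epsilon> > 0\<close> by (simp add: \<delta>_def)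
  have "(\<Sum>i<n. \<bar>integral {a..u i} f - integral {a..l i} f\<bar>) < \<epsilon>"
    if lu: "\<forall>i<n. l i < u i \<and> {l i..u i} \<subseteq> {a..b}"
      and dis: "disjoint_family_on (\<lambda>i. {l i<..<u i}) {..<n}" and len: "(\<Sum>i<n. u i - l i) < \<delta>"
    for n :: nat and l u
  proof -
    have ab: "a \<le> l i" "l i < u i" "u i \<le> b" if "i < n" for i
    proof -
      have "l i < u i" "{l i..u i} \<subseteq> {a..b}" using lu that by auto
      then show "a \<le> l i" "l i < u i" "u i \<le> b" by auto
    qed
    have fi: "f integrable_on {a..b}" using f absolutely_integrable_on_def by blast
    have sub: "F integrable_on {l i..u i}" if "F integrable_on {a..b}" "i < n" for F :: "real \<Rightarrow> real" and i
      using integrable_on_subinterval[OF that(1)] ab[OF that(2)] by auto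
    have Ri: "R k integrable_on {a..b}" using Rabs absolutely_integrable_on_def by blast
    have incr: "\<bar>integral {a..u i} f - integral {a..l i} f\<bar> \<le> integral {l i..u i} (R k) + real k * (u i - l i)"
      if i: "i < n" for i
    proof -
      have "integral {a..l i} f + integral {l i..u i} f = integral {a..u i} f"
        using ab[OF i] integrable_on_subinterval[OF fi]
        by (intro Henstock_Kurzweil_Integration.integral_combine) auto
      then have "\<bar>integral {a..u i} f - integral {a..l i} f\<bar> = norm (integral {l i..u i} f)"
        by (simp add: algebra_simps)
      also have "\<dots> \<le> integral {l i..u i} (\<lambda>x. R k x + real k)"
        using RA by (intro integral_norm_bound_integral integrable_add integrable_const_ivl sub[OF _ i] fi Ri)
          (auto simp: A_def)
      also have "\<dots> = integral {l i..u i} (R k) + real k * (u i - l i)"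
        using ab[OF i] by (subst integral_add) (auto intro!: sub[OF _ i] Ri)
      finally show ?thesis .
    qed
    have "(\<Sum>i<n. integral {l i..u i} (R k)) = (\<Sum>i<n. integral {l i<..<u i} (R k))"
      by (intro sum.cong refl) (simp add: integral_open_interval_real)
    also have "\<dots> = integral (\<Union>i<n. {l i<..<u i}) (R k)"
    proof (rule integral_unique[symmetric], rule has_integral_UN)
      show "(R k has_integral integral {l i<..<u i} (R k)) {l i<..<u i}" if "i \<in> {..<n}" for i
        using sub[OF Ri, of i] that by (simp add: integrable_on_open_interval_real has_integral_integral[symmetric])
      show "pairwise (\<lambda>i j. negligible ({l i<..<u i} \<inter> {l j<..<u j})) {..<n}"
        using dis unfolding pairwise_def disjoint_family_on_def by auto
    qed simp
    also have "\<dots> \<le> integral {a..b} (R k)"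
    proof (rule integral_subset_le)
      show "(\<Union>i<n. {l i<..<u i}) \<subseteq> {a..b}" using ab by force
      show "R k integrable_on (\<Union>i<n. {l i<..<u i})"
      proof -
        have "R k absolutely_integrable_on (\<Union>i<n. {l i<..<u i})"
          using ab by (intro set_integrable_subset[OF Rabs[of k]]) (force simp: less_imp_le)+
        then show ?thesis using absolutely_integrable_on_def by blast
      qed
    qed (use Ri Rnn in auto)
    finally have "(\<Sum>i<n. integral {l i..u i} (R k)) < \<epsilon>/2" using k by simp
    moreover have "(\<Sum>i<n. \<bar>integral {a..u i} f - integral {a..l i} f\<bar>)
        \<le> (\<Sum>i<n. integral {l i..u i} (R k) + real k * (u i - l i))"
      using incr by (intro sum_mono) auto
    moreover have "\<dots> = (\<Sum>i<n. integral {l i..u i} (R k)) + real k * (\<Sum>i<n. u i - l i)"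
      by (simp add: sum.distrib sum_distrib_left)
    moreover have "real k * (\<Sum>i<n. u i - l i) \<le> real k * \<delta>"
      using len by (intro mult_left_mono) auto
    moreover have "real k * \<delta> \<le> \<epsilon>/2"
      using \<open>\<epsilon> > 0\<close> by (simp add: \<delta>_def field_simps)
    ultimately show ?thesis by linarith
  qed
  then show "\<exists>\<delta>>0. \<forall>(n::nat) l u. (\<forall>i<n. l i < u i \<and> {l i..u i} \<subseteq> {a..b}) \<longrightarrow>
      disjoint_family_on (\<lambda>i. {l i<..<u i}) {..<n} \<longrightarrow> (\<Sum>i<n. u i - l i) < \<delta> \<longrightarrow>
      (\<Sum>i<n. \<bar>integral {a..u i} f - integral {a..l i} f\<bar>) < \<epsilon>"
    using \<open>\<delta> > 0\<close> by blast
qed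

section \<open>Derivatives of absolutely continuous functions\<close>

lemma absolutely_continuous_on_imp_indefinite_integral:
  assumes ac: "absolutely_continuous_on {a..b} f" and "a \<le> b"
  obtains h where "h absolutely_integrable_on {a..b}"
    "\<And>x. x \<in> {a..b} \<Longrightarrow> f x = f a + integral {a..x} h"
proof -
  obtain p q where pq: "absolutely_continuous_on {a..b} p" "absolutely_continuous_on {a..b} q"
    "mono_on {a..b} p" "mono_on {a..b} q" "\<And>x. f x = p x - q x"
    using absolutely_continuous_on_Jordan_decomposition[OF ac] by blast
  obtain hp where hp: "hp absolutely_integrable_on {a..b}"
    "\<And>x. x \<in> {a..b} \<Longrightarrow> p x = p a + integral {a..x} hp"
    using absolutely_continuous_mono_imp_indefinite_integral[OF pq(1,3) \<open>a \<le> b\<close>] by metis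
  obtain hq where hq: "hq absolutely_integrable_on {a..b}"
    "\<And>x. x \<in> {a..b} \<Longrightarrow> q x = q a + integral {a..x} hq"
    using absolutely_continuous_mono_imp_indefinite_integral[OF pq(2,4) \<open>a \<le> b\<close>] by metis
  show thesis
  proof (rule that)
    show "(\<lambda>x. hp x - hq x) absolutely_integrable_on {a..b}"
      by (rule set_integral_diff(1)[OF hp(1) hq(1)])
    fix x assume x: "x \<in> {a..b}"
    have "hp integrable_on {a..x}" "hq integrable_on {a..x}"
      using hp(1) hq(1) x unfolding absolutely_integrable_on_def
      by (auto intro: integrable_on_subinterval)
    then show "f x = f a + integral {a..x} (\<lambda>x. hp x - hq x)"
      using hp(2)[OF x] hq(2)[OF x] by (simp add: pq(5) integral_diff)
  qed
qed

lemma deriv_within_indefinite_integral_ae: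
  assumes "a < b" and h: "h absolutely_integrable_on {a..b}"
    and F: "\<And>x. x \<in> {a..b} \<Longrightarrow> F x = c + integral {a..x} h"
  obtains N where "negligible N" "\<And>x. x \<in> {a..b} - N \<Longrightarrow> deriv_within {a..b} F x = h x"
proof -
  have "h integrable_on {a..b}" using h absolutely_integrable_on_def by blast
  then obtain N where N: "negligible N" "\<And>x. x \<in> {a..b} - N \<Longrightarrow>
      ((\<lambda>x. integral {a..x} h) has_vector_derivative h x) (at x within {a..b})"
    using indefinite_integral_has_vector_derivative_ae by blast
  have "deriv_within {a..b} F x = h x" if x: "x \<in> {a..b} - N" for x
  proof -
    have "((\<lambda>x. c + integral {a..x} h) has_vector_derivative h x) (at x within {a..b})"
      using has_vector_derivative_add[OF has_vector_derivative_const N(2)[OF x], of c] by simp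
    then have "(F has_vector_derivative h x) (at x within {a..b})"
      using x F by (intro has_vector_derivative_transform[of x "{a..b}" F]) auto
    then show ?thesis
      using \<open>a < b\<close> x by (intro vector_derivative_within_closed_interval) auto
  qed
  with N(1) show thesis by (rule that)
qed

text \<open>
  The function \<open>deriv_within {a..b} f\<close> takes unspecified values where \<open>f\<close> is not differentiable. It is
  nevertheless measurable, because it agrees with a density of \<open>f\<close> outside a null set and Lebesgue
  measure is complete.
\<close>

lemma deriv_within_absolutely_integrable:
  assumes "absolutely_continuous_on {a..b} f" "a < b"
  shows "deriv_within {a..b} f absolutely_integrable_on {a..b}"
proof -
  obtain h where h: "h absolutely_integrable_on {a..b}"
    "\<And>x. x \<in> {a..b} \<Longrightarrow> f x = f a + integral {a..x} h"
    using absolutely_continuous_on_imp_indefinite_integral assms by (metis less_imp_le)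
  obtain N where "negligible N" "\<And>x. x \<in> {a..b} - N \<Longrightarrow> deriv_within {a..b} f x = h x"
    using deriv_within_indefinite_integral_ae[OF \<open>a < b\<close> h] by blast
  then show ?thesis by (rule absolutely_integrable_spike[OF h(1)])
qed

lemma deriv_within_mono_nonneg_ae:
  assumes "absolutely_continuous_on {a..b} f" "mono_on {a..b} f" "a < b"
  obtains N where "negligible N" "\<And>x. x \<in> {a..b} - N \<Longrightarrow> 0 \<le> deriv_within {a..b} f x"
proof -
  obtain h where h: "\<And>x. 0 \<le> h x" "h absolutely_integrable_on {a..b}"
    "\<And>x. x \<in> {a..b} \<Longrightarrow> f x = f a + integral {a..x} h"
    using absolutely_continuous_mono_imp_indefinite_integral assms by (metis less_imp_le)
  obtain N where "negligible N" "\<And>x. x \<in> {a..b} - N \<Longrightarrow> deriv_within {a..b} f x = h x"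
    using deriv_within_indefinite_integral_ae[OF \<open>a < b\<close> h(2,3)] by blast
  with that h(1) show thesis by metis
qed

lemma set_lebesgue_integral_spike:
  fixes f g :: "real \<Rightarrow> real"
  assumes "negligible N" "\<And>x. x \<in> S - N \<Longrightarrow> f x = g x" "g absolutely_integrable_on S"
  shows "(LINT x:S|lebesgue. f x) = (LINT x:S|lebesgue. g x)"
proof -
  have "f absolutely_integrable_on S"
    using absolutely_integrable_spike[OF assms(3,1)] assms(2) by auto
  moreover have "integral S f = integral S g"
    using assms(1,2) by (intro integral_spike[of N]) auto
  ultimately show ?thesis
    using assms(3) by (simp add: set_lebesgue_integral_eq_integral(2))
qed

section \<open>The index of lack of increase\<close>

text \<open>
  For real numbers \<open>\<bar>s - t\<bar> \<ge> max (- s) 0\<close> whenever \<open>t \<ge> 0\<close>, with equality for \<open>t = max s 0\<close>. Applied to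
  \<open>s = g' x\<close> and \<open>t = f' x\<close> the inequality is the lower bound, and the equality shows that the indefinite
  integral of the positive part of \<open>g'\<close> attains it.
\<close>

lemma LOI_attained:
  assumes "y > 0" and g: "g \<in> AC0 y"
  obtains f1 where "f1 \<in> AC0_mono y"
    "AE x in lebesgue_on {0..y}. deriv_within {0..y} f1 x = max (deriv_within {0..y} g x) 0"
    "(LINT x:{0..y}|lebesgue. \<bar>deriv_within {0..y} g x - deriv_within {0..y} f1 x\<bar>) = LOI y g"
    "LOI y g = (LINT x:{0..y}|lebesgue. max (- deriv_within {0..y} g x) 0)"
proof -
  define G where "G = deriv_within {0..y} g"
  have G_apply: "G x = deriv_within {0..y} g x" for x by (simp add: G_def)
  define p where "p x = max (G x) 0" for x
  define f1 where "f1 x = integral {0..x} p" for x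
  have G: "G absolutely_integrable_on {0..y}"
    unfolding G_def using g \<open>y > 0\<close> by (intro deriv_within_absolutely_integrable) (auto simp: AC0_def)
  have p: "p absolutely_integrable_on {0..y}"
    unfolding p_def by (intro absolutely_integrable_max_1 G) (simp add: set_integrable_def)
  have neg: "(\<lambda>x. max (- G x) 0) absolutely_integrable_on {0..y}"
    using set_integrable_mult_right[OF G, of "-1"]
    by (intro absolutely_integrable_max_1) (simp_all add: set_integrable_def)
  have f1: "f1 \<in> AC0_mono y"
  proof -
    have "absolutely_continuous_on {0..y} f1"
      unfolding f1_def by (rule absolutely_continuous_on_indefinite_integral[OF p])
    moreover have "f1 0 = 0" by (simp add: f1_def)
    moreover have "f1 s \<le> f1 t" if "s \<in> {0..y}" "t \<in> {0..y}" "s \<le> t" for s t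
      unfolding f1_def using p that unfolding absolutely_integrable_on_def
      by (intro integral_subset_le) (auto simp: p_def intro: integrable_on_subinterval)
    ultimately show ?thesis by (auto simp: AC0_mono_def AC0_def mono_on_def)
  qed
  obtain N where N: "negligible N" "\<And>x. x \<in> {0..y} - N \<Longrightarrow> deriv_within {0..y} f1 x = p x"
    using deriv_within_indefinite_integral_ae[OF \<open>y > 0\<close> p, of f1 0] by (auto simp: f1_def)
  have value1: "(LINT x:{0..y}|lebesgue. \<bar>G x - deriv_within {0..y} f1 x\<bar>)
      = (LINT x:{0..y}|lebesgue. max (- G x) 0)"
    by (rule set_lebesgue_integral_spike[OF N(1) _ neg]) (auto simp: N(2) p_def)
  have lower: "(LINT x:{0..y}|lebesgue. max (- G x) 0)
      \<le> (LINT x:{0..y}|lebesgue. \<bar>G x - deriv_within {0..y} f x\<bar>)" if f: "f \<in> AC0_mono y" for f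
  proof -
    have acf: "absolutely_continuous_on {0..y} f" "mono_on {0..y} f"
      using f by (auto simp: AC0_mono_def AC0_def)
    obtain M where M: "negligible M" "\<And>x. x \<in> {0..y} - M \<Longrightarrow> 0 \<le> deriv_within {0..y} f x"
      using deriv_within_mono_nonneg_ae[OF acf \<open>y > 0\<close>] by blast
    have "(\<lambda>x. \<bar>G x - deriv_within {0..y} f x\<bar>) absolutely_integrable_on {0..y}"
      using absolutely_integrable_norm[OF set_integral_diff(1)[OF G
        deriv_within_absolutely_integrable[OF acf(1) \<open>y > 0\<close>]]] by (simp add: comp_def)
    moreover have "AE x \<in> {0..y} in lebesgue. max (- G x) 0 \<le> \<bar>G x - deriv_within {0..y} f x\<bar>"
      unfolding eventually_ae_filter_negligible using M by (intro exI[of _ M]) fastforce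
    ultimately show ?thesis
      using neg by (intro set_integral_mono_AE)
  qed
  have LOI: "LOI y g = (LINT x:{0..y}|lebesgue. max (- G x) 0)"
    unfolding LOI_def G_apply[symmetric]
  proof (rule cInf_eq_minimum)
    show "(LINT x:{0..y}|lebesgue. max (- G x) 0)
        \<in> (\<lambda>f. LINT x:{0..y}|lebesgue. \<bar>G x - deriv_within {0..y} f x\<bar>) ` AC0_mono y"
      using f1 value1 by (intro image_eqI[of _ _ f1]) auto
  next
    fix z assume "z \<in> (\<lambda>f. LINT x:{0..y}|lebesgue. \<bar>G x - deriv_within {0..y} f x\<bar>) ` AC0_mono y"
    with lower show "(LINT x:{0..y}|lebesgue. max (- G x) 0) \<le> z" by fast
  qed
  show thesis
  proof (rule that[OF f1])
    have "AE x in lebesgue. x \<in> {0..y} \<longrightarrow> deriv_within {0..y} f1 x = max (deriv_within {0..y} g x) 0"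
      unfolding eventually_ae_filter_negligible using N by (intro exI[of _ N]) (auto simp: p_def G_def)
    then show "AE x in lebesgue_on {0..y}. deriv_within {0..y} f1 x = max (deriv_within {0..y} g x) 0"
      by (subst AE_restrict_space_iff) auto
  qed (use LOI value1 in \<open>simp_all add: G_def\<close>)
qed

lemma absolutely_continuous_on_translate:
  assumes "absolutely_continuous_on {a..b} f"
  shows "absolutely_continuous_on {0..b - a} (\<lambda>x. f (x + a) - c)"
  unfolding absolutely_continuous_on_def
proof (intro allI impI)
  fix \<epsilon> :: real assume "\<epsilon> > 0"
  obtain \<delta> where "\<delta> > 0" and \<delta>: "\<And>(I::nat set) l u. finite I \<Longrightarrow>
      (\<And>i. i \<in> I \<Longrightarrow> l i \<le> u i) \<Longrightarrow> (\<And>i. i \<in> I \<Longrightarrow> {l i..u i} \<subseteq> {a..b}) \<Longrightarrow>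
      disjoint_family_on (\<lambda>i. {l i<..<u i}) I \<Longrightarrow> (\<Sum>i\<in>I. u i - l i) < \<delta> \<Longrightarrow>
      (\<Sum>i\<in>I. \<bar>f (u i) - f (l i)\<bar>) < \<epsilon>"
    by (fact absolutely_continuous_on_finite_family[OF assms \<open>\<epsilon> > 0\<close>])
  have "(\<Sum>i<n. \<bar>f (u i + a) - c - (f (l i + a) - c)\<bar>) < \<epsilon>"
    if lu: "\<forall>i<n. l i < u i \<and> {l i..u i} \<subseteq> {0..b - a}"
      and dis: "disjoint_family_on (\<lambda>i. {l i<..<u i}) {..<n}" and len: "(\<Sum>i<n. u i - l i) < \<delta>"
    for n :: nat and l u
  proof -
    have "(\<Sum>i<n. \<bar>f (u i + a) - f (l i + a)\<bar>) < \<epsilon>"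
    proof (rule \<delta>)
      fix i assume "i \<in> {..<n}"
      then have "l i < u i" "{l i..u i} \<subseteq> {0..b - a}" using lu by auto
      then show "l i + a \<le> u i + a" "{l i + a..u i + a} \<subseteq> {a..b}" by auto
    next
      show "disjoint_family_on (\<lambda>i. {l i + a<..<u i + a}) {..<n}"
        using dis unfolding disjoint_family_on_def by (auto simp: min_def max_def split: if_splits)
    qed (use len in auto)
    then show ?thesis by simp
  qed
  then show "\<exists>\<delta>>0. \<forall>(n::nat) l u. (\<forall>i<n. l i < u i \<and> {l i..u i} \<subseteq> {0..b - a}) \<longrightarrow>
      disjoint_family_on (\<lambda>i. {l i<..<u i}) {..<n} \<longrightarrow> (\<Sum>i<n. u i - l i) < \<delta> \<longrightarrow>
      (\<Sum>i<n. \<bar>f (u i + a) - c - (f (l i + a) - c)\<bar>) < \<epsilon>"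
    using \<open>\<delta> > 0\<close> by blast
qed

text \<open>
  This holds at every point, differentiable or not: \<open>vector_derivative\<close> is chosen from the set of
  derivatives, and both sides have the same set.
\<close>

lemma deriv_within_translate:
  "deriv_within {0..b - a} (\<lambda>x. f (x + a) - c) x = deriv_within {a..b} f (x + a)"
proof -
  have "((\<lambda>x. f (x + a) - c) has_vector_derivative D) (at x within {0..b - a}) \<longleftrightarrow>
      (f has_vector_derivative D) (at (x + a) within {a..b})" for D
  proof -
    have "((\<lambda>x. f (x + a) - c) has_vector_derivative D) (at x within {0..b - a}) \<longleftrightarrow>
        ((\<lambda>x. f (a + x)) has_field_derivative D) (at x within {0..b - a})"
      unfolding has_real_derivative_iff_has_vector_derivative[symmetric]
      by (auto simp: has_field_derivative_iff add.commute)
    also have "\<dots> \<longleftrightarrow> (f has_field_derivative D) (at (a + x) within (+) a ` {0..b - a})"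
      by (rule DERIV_at_within_shift[symmetric])
    also have "(+) a ` {0..b - a} = {a..b}" by simp
    finally show ?thesis
      by (simp add: has_real_derivative_iff_has_vector_derivative add.commute)
  qed
  then show ?thesis by (simp add: vector_derivative_def)
qed

lemma set_lebesgue_integral_translate:
  fixes f :: "real \<Rightarrow> real"
  assumes f: "f absolutely_integrable_on {a..b}" and nn: "\<And>x. 0 \<le> f x"
  shows "(LINT x:{0..b - a}|lebesgue. f (x + a)) = (LINT x:{a..b}|lebesgue. f x)"
proof -
  have "(f has_integral integral {a..b} f) (cbox a b)"
    using set_lebesgue_integral_eq_integral(1)[OF f] by (simp add: cbox_interval integrable_integral)
  from has_integral_affinity'[OF this, of 1 a]
  have *: "((\<lambda>x. f (x + a)) has_integral integral {a..b} f) {0..b - a}"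
    by (simp add: cbox_interval)
  then have "(\<lambda>x. f (x + a)) absolutely_integrable_on {0..b - a}"
    using nn by (intro nonnegative_absolutely_integrable_1) auto
  then show ?thesis
    using f integral_unique[OF *] by (simp add: set_lebesgue_integral_eq_integral(2))
qed

lemma LOI_on_eq:
  assumes "a < b" and g0: "absolutely_continuous_on {a..b} g0"
  shows "LOI_on a b g0 = (LINT x:{a..b}|lebesgue. max (- deriv_within {a..b} g0 x) 0)"
proof -
  have "(\<lambda>x. g0 (x + a) - g0 a) \<in> AC0 (b - a)"
    using absolutely_continuous_on_translate[OF g0] by (simp add: AC0_def)
  then have "LOI (b - a) (\<lambda>x. g0 (x + a) - g0 a) =
      (LINT x:{0..b - a}|lebesgue. max (- deriv_within {0..b - a} (\<lambda>x. g0 (x + a) - g0 a) x) 0)"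
    by (rule LOI_attained[rotated]) (use \<open>a < b\<close> in simp_all)
  then have "LOI_on a b g0 = (LINT x:{0..b - a}|lebesgue. max (- deriv_within {a..b} g0 (x + a)) 0)"
    unfolding LOI_on_def deriv_within_translate .
  also have "\<dots> = (LINT x:{a..b}|lebesgue. max (- deriv_within {a..b} g0 x) 0)"
  proof (rule set_lebesgue_integral_translate)
    have "(\<lambda>x. - deriv_within {a..b} g0 x) absolutely_integrable_on {a..b}"
      using set_integrable_mult_right[OF deriv_within_absolutely_integrable[OF g0 \<open>a < b\<close>], of "-1"] by simp
    then show "(\<lambda>x. max (- deriv_within {a..b} g0 x) 0) absolutely_integrable_on {a..b}"
      by (intro absolutely_integrable_max_1) (simp_all add: set_integrable_def)
  qed simp
  finally show ?thesis .
qed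

theorem theorem1:
  shows "(\<forall>(y::real) g. y > 0 \<longrightarrow> g \<in> AC0 y \<longrightarrow>
            (\<exists>f1\<in>AC0_mono y.
               (AE x in lebesgue_on {0..y}.
                  deriv_within {0..y} f1 x = max (deriv_within {0..y} g x) 0) \<and>
               (LINT x:{0..y}|lebesgue.
                  \<bar>deriv_within {0..y} g x - deriv_within {0..y} f1 x\<bar>) = LOI y g) \<and>
            LOI y g = (LINT x:{0..y}|lebesgue. max (- deriv_within {0..y} g x) 0)) \<and>
         (\<forall>(a::real) b g0. a < b \<longrightarrow> absolutely_continuous_on {a..b} g0 \<longrightarrow>
            LOI_on a b g0 = (LINT x:{a..b}|lebesgue. max (- deriv_within {a..b} g0 x) 0))"
proof (intro conjI allI impI)
  fix y :: real and g assume "y > 0" "g \<in> AC0 y"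
  then have y: "y > 0" and g: "g \<in> AC0 y" by auto
  obtain f1 where f1: "f1 \<in> AC0_mono y"
    "AE x in lebesgue_on {0..y}. deriv_within {0..y} f1 x = max (deriv_within {0..y} g x) 0"
    "(LINT x:{0..y}|lebesgue. \<bar>deriv_within {0..y} g x - deriv_within {0..y} f1 x\<bar>) = LOI y g"
    "LOI y g = (LINT x:{0..y}|lebesgue. max (- deriv_within {0..y} g x) 0)"
    by (fact LOI_attained[OF y g])
  from f1(1-3) show "\<exists>f1\<in>AC0_mono y.
      (AE x in lebesgue_on {0..y}. deriv_within {0..y} f1 x = max (deriv_within {0..y} g x) 0) \<and>
      (LINT x:{0..y}|lebesgue. \<bar>deriv_within {0..y} g x - deriv_within {0..y} f1 x\<bar>) = LOI y g"
    by blast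
  show "LOI y g = (LINT x:{0..y}|lebesgue. max (- deriv_within {0..y} g x) 0)" by (fact f1(4))
qed (fact LOI_on_eq)

end
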